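(* Let $\mathbb{C}$ be a pointed category admitting binary products and coequalisers, and suppose that binary products commute with coequalisers in $\mathbb{C}$. Then $\mathbb{C}$ is centralic.
   Context: A pointed category is a category with a zero object $0$; zero morphisms are also denoted $0$. For morphisms $x\colon S\to X$, $y\colon S\to Y$, $f\colon X\times Y\to Z$, write $f(x,y)$ for the composite $f\circ(x,y)\colon S\to Z$. A pointed category with finite products is called centralic if for every morphism $f\colon X\times Y\to Z$, every object $S$ and all morphisms $x,x'\colon S\to X$, $y\colon S\to Y$: $f(x,0)=f(x',0)$ implies $f(x,y)=f(x',y)$. Binary products commute with coequalisers in $\mathbb{C}$ if for any two coequaliser diagrams $C_1\rightrightarrows X_1\xrightarrow{q_1}Q_1$ (of $u_1,v_1$) and $C_2\rightrightarrows X_2\xrightarrow{q_2}Q_2$ (of $u_2,v_2$) in $\mathbb{C}$, the morphism $q_1\times q_2\colon X_1\times X_2\to Q_1\times Q_2$ is a coequaliser of $u_1\times u_2,\ v_1\times v_2\colon C_1\times C_2\to X_1\times X_2$. *)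

theory Defs
  imports Main
begin

text \<open>
  Composition is written in applicative order: \<open>g \<cdot>\<^bsub>C\<^esub> f\<close> is ``first \<open>f\<close>, then \<open>g\<close>''.
  Values of the operations outside the carriers \<open>Obj\<close> and \<open>Arr\<close> are unconstrained and
  never used.
\<close>

record ('o, 'm) category_data =
  Obj :: "'o set"
  Arr :: "'m set"
  Dom :: "'m \<Rightarrow> 'o"
  Cod :: "'m \<Rightarrow> 'o"
  Ide :: "'o \<Rightarrow> 'm"
  Comp :: "'m \<Rightarrow> 'm \<Rightarrow> 'm"  (infixl "\<cdot>\<index>" 70)

definition hom :: "('o, 'm, 'e) category_data_scheme \<Rightarrow> 'o \<Rightarrow> 'o \<Rightarrow> 'm set" where
  "hom C X Y = {f \<in> Arr C. Dom C f = X \<and> Cod C f = Y}"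

locale category =
  fixes C :: "('o, 'm, 'e) category_data_scheme" (structure)
  assumes Dom_in_Obj: "f \<in> Arr C \<Longrightarrow> Dom C f \<in> Obj C"
    and Cod_in_Obj: "f \<in> Arr C \<Longrightarrow> Cod C f \<in> Obj C"
    and Ide_in_hom: "X \<in> Obj C \<Longrightarrow> Ide C X \<in> hom C X X"
    and Comp_in_hom: "\<lbrakk>f \<in> hom C X Y; g \<in> hom C Y Z\<rbrakk> \<Longrightarrow> g \<cdot> f \<in> hom C X Z"
    and Comp_Ide: "f \<in> hom C X Y \<Longrightarrow> f \<cdot> Ide C X = f"
    and Ide_Comp: "f \<in> hom C X Y \<Longrightarrow> Ide C Y \<cdot> f = f"
    and Comp_assoc:
      "\<lbrakk>f \<in> hom C W X; g \<in> hom C X Y; h \<in> hom C Y Z\<rbrakk> \<Longrightarrow> (h \<cdot> g) \<cdot> f = h \<cdot> (g \<cdot> f)"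


subsection \<open>Zero objects and zero morphisms\<close>

definition is_initial :: "('o, 'm, 'e) category_data_scheme \<Rightarrow> 'o \<Rightarrow> bool" where
  "is_initial C I \<longleftrightarrow> I \<in> Obj C \<and> (\<forall>X \<in> Obj C. \<exists>!f. f \<in> hom C I X)"

definition is_terminal :: "('o, 'm, 'e) category_data_scheme \<Rightarrow> 'o \<Rightarrow> bool" where
  "is_terminal C T \<longleftrightarrow> T \<in> Obj C \<and> (\<forall>X \<in> Obj C. \<exists>!f. f \<in> hom C X T)"

definition is_zero_object :: "('o, 'm, 'e) category_data_scheme \<Rightarrow> 'o \<Rightarrow> bool" where
  "is_zero_object C N \<longleftrightarrow> is_initial C N \<and> is_terminal C N"

locale pointed_category = category +
  assumes ex_zero_object: "\<exists>N. is_zero_object C N"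

text \<open>
  In a pointed category exactly one morphism \<open>X \<rightarrow> Y\<close> factors through a zero object, and it
  does not depend on which zero object is used.
\<close>

definition zero_mor :: "('o, 'm, 'e) category_data_scheme \<Rightarrow> 'o \<Rightarrow> 'o \<Rightarrow> 'm" where
  "zero_mor C X Y =
    (THE z. \<exists>N a b. is_zero_object C N \<and> a \<in> hom C X N \<and> b \<in> hom C N Y \<and> z = b \<cdot>\<^bsub>C\<^esub> a)"


subsection \<open>Products\<close>

definition is_product ::
    "('o, 'm, 'e) category_data_scheme \<Rightarrow> 'i set \<Rightarrow> ('i \<Rightarrow> 'o) \<Rightarrow> 'o \<Rightarrow> ('i \<Rightarrow> 'm) \<Rightarrow> bool" where
  "is_product C I X P p \<longleftrightarrow>
    P \<in> Obj C \<and> (\<forall>i \<in> I. p i \<in> hom C P (X i)) \<and>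
    (\<forall>S \<in> Obj C. \<forall>x. (\<forall>i \<in> I. x i \<in> hom C S (X i)) \<longrightarrow>
      (\<exists>!h. h \<in> hom C S P \<and> (\<forall>i \<in> I. p i \<cdot>\<^bsub>C\<^esub> h = x i)))"

text \<open>The empty family (\<open>n = 0\<close>) is included, so finite products include a terminal object.\<close>

definition has_finite_products :: "('o, 'm, 'e) category_data_scheme \<Rightarrow> bool" where
  "has_finite_products C \<longleftrightarrow>
    (\<forall>(n :: nat) X. (\<forall>i < n. X i \<in> Obj C) \<longrightarrow> (\<exists>P p. is_product C {..<n} X P p))"

definition is_binary_product ::
    "('o, 'm, 'e) category_data_scheme \<Rightarrow> 'o \<Rightarrow> 'o \<Rightarrow> 'o \<times> 'm \<times> 'm \<Rightarrow> bool" where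
  "is_binary_product C X Y = (\<lambda>(P, p1, p2).
    P \<in> Obj C \<and> p1 \<in> hom C P X \<and> p2 \<in> hom C P Y \<and>
    (\<forall>S \<in> Obj C. \<forall>x \<in> hom C S X. \<forall>y \<in> hom C S Y.
      \<exists>!h. h \<in> hom C S P \<and> p1 \<cdot>\<^bsub>C\<^esub> h = x \<and> p2 \<cdot>\<^bsub>C\<^esub> h = y))"

definition has_binary_products :: "('o, 'm, 'e) category_data_scheme \<Rightarrow> bool" where
  "has_binary_products C \<longleftrightarrow> (\<forall>X \<in> Obj C. \<forall>Y \<in> Obj C. \<exists>D. is_binary_product C X Y D)"

text \<open>
  When binary products exist, \<open>X \<times> Y\<close> denotes an arbitrary but fixed product diagram.
  The notions defined below do not depend on the choice, since any two product diagrams of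
  the same objects are canonically isomorphic.
\<close>

definition product_diagram :: "('o, 'm, 'e) category_data_scheme \<Rightarrow> 'o \<Rightarrow> 'o \<Rightarrow> 'o \<times> 'm \<times> 'm" where
  "product_diagram C X Y = (SOME D. is_binary_product C X Y D)"

definition prod_obj :: "('o, 'm, 'e) category_data_scheme \<Rightarrow> 'o \<Rightarrow> 'o \<Rightarrow> 'o" where
  "prod_obj C X Y = fst (product_diagram C X Y)"

definition proj1 :: "('o, 'm, 'e) category_data_scheme \<Rightarrow> 'o \<Rightarrow> 'o \<Rightarrow> 'm" where
  "proj1 C X Y = fst (snd (product_diagram C X Y))"

definition proj2 :: "('o, 'm, 'e) category_data_scheme \<Rightarrow> 'o \<Rightarrow> 'o \<Rightarrow> 'm" where
  "proj2 C X Y = snd (snd (product_diagram C X Y))"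

text \<open>The morphism \<open>(x, y) : S \<rightarrow> X \<times> Y\<close>, for \<open>x : S \<rightarrow> X\<close> and \<open>y : S \<rightarrow> Y\<close>.\<close>

definition pairing :: "('o, 'm, 'e) category_data_scheme \<Rightarrow> 'm \<Rightarrow> 'm \<Rightarrow> 'm" where
  "pairing C x y =
    (THE h. h \<in> hom C (Dom C x) (prod_obj C (Cod C x) (Cod C y)) \<and>
      proj1 C (Cod C x) (Cod C y) \<cdot>\<^bsub>C\<^esub> h = x \<and>
      proj2 C (Cod C x) (Cod C y) \<cdot>\<^bsub>C\<^esub> h = y)"

text \<open>The morphism \<open>f \<times> g : X \<times> X' \<rightarrow> Y \<times> Y'\<close>, for \<open>f : X \<rightarrow> Y\<close> and \<open>g : X' \<rightarrow> Y'\<close>.\<close>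

definition prod_mor :: "('o, 'm, 'e) category_data_scheme \<Rightarrow> 'm \<Rightarrow> 'm \<Rightarrow> 'm" where
  "prod_mor C f g =
    pairing C (f \<cdot>\<^bsub>C\<^esub> proj1 C (Dom C f) (Dom C g)) (g \<cdot>\<^bsub>C\<^esub> proj2 C (Dom C f) (Dom C g))"


subsection \<open>Coequalisers\<close>

definition is_coequaliser :: "('o, 'm, 'e) category_data_scheme \<Rightarrow> 'm \<Rightarrow> 'm \<Rightarrow> 'm \<Rightarrow> bool" where
  "is_coequaliser C u v q \<longleftrightarrow>
    (\<exists>A X Q. u \<in> hom C A X \<and> v \<in> hom C A X \<and> q \<in> hom C X Q \<and>
      q \<cdot>\<^bsub>C\<^esub> u = q \<cdot>\<^bsub>C\<^esub> v \<and>
      (\<forall>Z \<in> Obj C. \<forall>h \<in> hom C X Z. h \<cdot>\<^bsub>C\<^esub> u = h \<cdot>\<^bsub>C\<^esub> v \<longrightarrow>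
        (\<exists>!k. k \<in> hom C Q Z \<and> k \<cdot>\<^bsub>C\<^esub> q = h)))"

definition has_coequalisers :: "('o, 'm, 'e) category_data_scheme \<Rightarrow> bool" where
  "has_coequalisers C \<longleftrightarrow>
    (\<forall>A \<in> Obj C. \<forall>X \<in> Obj C. \<forall>u \<in> hom C A X. \<forall>v \<in> hom C A X. \<exists>q. is_coequaliser C u v q)"

definition binary_products_commute_with_coequalisers ::
    "('o, 'm, 'e) category_data_scheme \<Rightarrow> bool" where
  "binary_products_commute_with_coequalisers C \<longleftrightarrow>
    (\<forall>u1 v1 q1 u2 v2 q2. is_coequaliser C u1 v1 q1 \<longrightarrow> is_coequaliser C u2 v2 q2 \<longrightarrow>
      is_coequaliser C (prod_mor C u1 u2) (prod_mor C v1 v2) (prod_mor C q1 q2))"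


subsection \<open>Centralic categories\<close>

definition centralic :: "('o, 'm, 'e) category_data_scheme \<Rightarrow> bool" where
  "centralic C \<longleftrightarrow> pointed_category C \<and> has_finite_products C \<and>
    (\<forall>X \<in> Obj C. \<forall>Y \<in> Obj C. \<forall>Z \<in> Obj C. \<forall>S \<in> Obj C.
      \<forall>f \<in> hom C (prod_obj C X Y) Z. \<forall>x \<in> hom C S X. \<forall>x' \<in> hom C S X. \<forall>y \<in> hom C S Y.
        f \<cdot>\<^bsub>C\<^esub> pairing C x (zero_mor C S Y) = f \<cdot>\<^bsub>C\<^esub> pairing C x' (zero_mor C S Y) \<longrightarrow>
        f \<cdot>\<^bsub>C\<^esub> pairing C x y = f \<cdot>\<^bsub>C\<^esub> pairing C x' y)"

end

theory Submission
  imports Defs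
begin

text \<open>
  Given \<open>f : X \<times> Y \<rightarrow> Z\<close> with \<open>f (x, 0) = f (x', 0)\<close>, let \<open>q : X \<rightarrow> Q\<close> be the coequaliser of
  \<open>x, x' : S \<rightarrow> X\<close>. The identity of \<open>Y\<close> is a coequaliser of any pair of equal morphisms into \<open>Y\<close>,
  in particular of \<open>0, 0 : S \<rightarrow> Y\<close>; so, by commutation, \<open>q \<times> 1\<close> is a coequaliser of
  \<open>x \<times> 0, x' \<times> 0 : S \<times> S \<rightarrow> X \<times> Y\<close>. Since \<open>0\<close> absorbs composition,
  \<open>x \<times> 0 = (x, 0) \<circ> \<pi>\<^sub>1\<close> (lemma \<open>prod_mor_zero\<close>), and likewise for \<open>x'\<close>. The hypothesis on \<open>f\<close>
  therefore says that \<open>f\<close> coequalises this pair, hence \<open>f = k (q \<times> 1)\<close> for some \<open>k\<close>. Consequently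
  \<open>f (x, y) = k (q x, y) = k (q x', y) = f (x', y)\<close> for every \<open>y\<close>: a factorisation obtained from
  the values at \<open>y = 0\<close> controls \<open>f\<close> at every \<open>y\<close>.

  The finite products demanded of a centralic category are built from binary ones by induction,
  starting from the zero object as the empty product.
\<close>

section \<open>Zero morphisms and coequalisers\<close>

lemma homD:
  assumes "f \<in> hom C X Y"
  shows "Dom C f = X" "Cod C f = Y"
  using assms by (simp_all add: hom_def)

context category
begin

lemma hom_objects:
  assumes "f \<in> hom C X Y"
  shows "X \<in> Obj C" "Y \<in> Obj C"
  using assms Dom_in_Obj Cod_in_Obj by (auto simp: hom_def)

text \<open>
  The comparison \<open>t : N' \<rightarrow> N\<close> between the two zero objects satisfies \<open>t a' = a\<close> because \<open>N\<close> is
  terminal and \<open>b t = b'\<close> because \<open>N'\<close> is initial, so both composites equal \<open>b t a'\<close>.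
\<close>

lemma zero_factorisation_unique:
  assumes N: "is_zero_object C N" and N': "is_zero_object C N'"
    and a: "a \<in> hom C X N" and b: "b \<in> hom C N Y"
    and a': "a' \<in> hom C X N'" and b': "b' \<in> hom C N' Y"
  shows "b \<cdot> a = b' \<cdot> a'"
proof -
  have "N \<in> Obj C"
    using N by (simp add: is_zero_object_def is_initial_def)
  then obtain t where t: "t \<in> hom C N' N"
    using N' by (auto simp: is_zero_object_def is_initial_def)
  have "t \<cdot> a' = a"
    using Comp_in_hom[OF a' t] a N hom_objects[OF a]
    by (auto simp: is_zero_object_def is_terminal_def)
  moreover have "b \<cdot> t = b'"
    using Comp_in_hom[OF t b] b' N' hom_objects[OF b]
    by (auto simp: is_zero_object_def is_initial_def)
  ultimately show ?thesis
    using Comp_assoc[OF a' t b] by simp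
qed

lemma zero_mor_eq_Comp:
  assumes "is_zero_object C N" "a \<in> hom C X N" "b \<in> hom C N Y"
  shows "zero_mor C X Y = b \<cdot> a"
  unfolding zero_mor_def using assms zero_factorisation_unique by (intro the_equality) blast+

lemma coequaliser_of_equal_pair:
  assumes u: "u \<in> hom C A X"
  shows "is_coequaliser C u u (Ide C X)"
proof -
  have "Ide C X \<in> hom C X X"
    using Ide_in_hom hom_objects[OF u] by blast
  moreover have "\<exists>!k. k \<in> hom C X Z \<and> k \<cdot> Ide C X = h" if "h \<in> hom C X Z" for Z h
    using that by (auto simp: Comp_Ide)
  ultimately show ?thesis
    unfolding is_coequaliser_def using u by blast
qed

lemma coequaliser_factorisation:
  assumes q: "is_coequaliser C u v q"
    and u: "u \<in> hom C A X" and h: "h \<in> hom C X Z" and eq: "h \<cdot> u = h \<cdot> v"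
  obtains k where "k \<in> hom C (Cod C q) Z" "k \<cdot> q = h"
proof -
  from q obtain A' X' Q where *: "u \<in> hom C A' X'" "q \<in> hom C X' Q"
    and univ: "\<forall>Z \<in> Obj C. \<forall>h \<in> hom C X' Z. h \<cdot> u = h \<cdot> v \<longrightarrow>
        (\<exists>!k. k \<in> hom C Q Z \<and> k \<cdot> q = h)"
    unfolding is_coequaliser_def by blast
  have "X' = X" "Cod C q = Q"
    using * u by (auto dest: homD)
  then show thesis
    using univ h eq hom_objects(2)[OF h] that by blast
qed

section \<open>Finite products from binary products\<close>

text \<open>
  A product of \<open>n + 1\<close> objects is the binary product of a product of the first \<open>n\<close> with the last.
\<close>

lemma finite_products_from_binary_products:
  assumes T: "is_terminal C T" and bin: "has_binary_products C"
  shows "has_finite_products C"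
proof -
  have "\<exists>P p. is_product C {..<n} X P p" if "\<forall>i < n. X i \<in> Obj C" for n :: nat and X
    using that
  proof (induction n)
    case 0
    have "is_product C {..<0} X T p" for p
      using T by (simp add: is_product_def is_terminal_def)
    then show ?case by blast
  next
    case (Suc n)
    then obtain P p where P: "is_product C {..<n} X P p" by auto
    then have PO: "P \<in> Obj C" and p: "\<And>i. i < n \<Longrightarrow> p i \<in> hom C P (X i)"
      by (auto simp: is_product_def)
    have "X n \<in> Obj C" using Suc.prems by simp
    then obtain R r1 r2 where R: "is_binary_product C P (X n) (R, r1, r2)"
      using bin PO unfolding has_binary_products_def by (metis prod_cases3)
    then have RO: "R \<in> Obj C" and r1: "r1 \<in> hom C R P" and r2: "r2 \<in> hom C R (X n)"
      by (auto simp: is_binary_product_def)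
    define r where "r i = (if i < n then p i \<cdot> r1 else r2)" for i
    have r: "r i \<in> hom C R (X i)" if "i < Suc n" for i
      using that p Comp_in_hom[OF r1] r2 less_Suc_eq by (auto simp: r_def)
    have "\<exists>!h. h \<in> hom C S R \<and> (\<forall>i \<in> {..<Suc n}. r i \<cdot> h = x i)"
      if S: "S \<in> Obj C" and x: "\<forall>i \<in> {..<Suc n}. x i \<in> hom C S (X i)" for S x
    proof -
      have "\<exists>!g. g \<in> hom C S P \<and> (\<forall>i \<in> {..<n}. p i \<cdot> g = x i)"
        using P S x by (simp add: is_product_def)
      then obtain g where g: "g \<in> hom C S P" "\<forall>i \<in> {..<n}. p i \<cdot> g = x i"
        and g_unique: "\<And>g'. g' \<in> hom C S P \<Longrightarrow> \<forall>i \<in> {..<n}. p i \<cdot> g' = x i \<Longrightarrow> g' = g"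
        by blast
      have "\<exists>!h. h \<in> hom C S R \<and> r1 \<cdot> h = g \<and> r2 \<cdot> h = x n"
        using R S g(1) x by (simp add: is_binary_product_def)
      moreover have "(\<forall>i \<in> {..<Suc n}. r i \<cdot> h = x i) \<longleftrightarrow> r1 \<cdot> h = g \<and> r2 \<cdot> h = x n"
        if h: "h \<in> hom C S R" for h
      proof -
        have "r i \<cdot> h = p i \<cdot> (r1 \<cdot> h)" if "i < n" for i
          using that Comp_assoc[OF h r1 p] by (simp add: r_def)
        moreover have "r n \<cdot> h = r2 \<cdot> h" by (simp add: r_def)
        ultimately have "(\<forall>i \<in> {..<Suc n}. r i \<cdot> h = x i) \<longleftrightarrow>
            (\<forall>i \<in> {..<n}. p i \<cdot> (r1 \<cdot> h) = x i) \<and> r2 \<cdot> h = x n"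
          by (auto simp: less_Suc_eq)
        then show ?thesis
          using g g_unique[OF Comp_in_hom[OF h r1]] by auto
      qed
      ultimately show ?thesis by metis
    qed
    then have "is_product C {..<Suc n} X R r"
      unfolding is_product_def using RO r by blast
    then show ?case by blast
  qed
  then show ?thesis unfolding has_finite_products_def by blast
qed

end

section \<open>Calculus of pairings\<close>

locale category_with_binary_products = category +
  assumes binary_products: "has_binary_products C"
begin

lemma is_binary_product_chosen:
  assumes "X \<in> Obj C" "Y \<in> Obj C"
  shows "is_binary_product C X Y (prod_obj C X Y, proj1 C X Y, proj2 C X Y)"
proof -
  have "\<exists>D. is_binary_product C X Y D"
    using binary_products assms by (simp add: has_binary_products_def)
  then have "is_binary_product C X Y (product_diagram C X Y)"
    unfolding product_diagram_def by (rule someI_ex)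
  then show ?thesis by (simp add: prod_obj_def proj1_def proj2_def)
qed

lemma proj_in_hom:
  assumes "X \<in> Obj C" "Y \<in> Obj C"
  shows "proj1 C X Y \<in> hom C (prod_obj C X Y) X" "proj2 C X Y \<in> hom C (prod_obj C X Y) Y"
  using is_binary_product_chosen[OF assms] by (auto simp: is_binary_product_def)

lemma prod_universal:
  assumes x: "x \<in> hom C S X" and y: "y \<in> hom C S Y"
  shows "\<exists>!h. h \<in> hom C S (prod_obj C X Y) \<and> proj1 C X Y \<cdot> h = x \<and> proj2 C X Y \<cdot> h = y"
  using is_binary_product_chosen[OF hom_objects(2)[OF x] hom_objects(2)[OF y]]
    hom_objects(1)[OF x] x y
  by (simp add: is_binary_product_def)

lemma pairing_props:
  assumes x: "x \<in> hom C S X" and y: "y \<in> hom C S Y"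
  shows "pairing C x y \<in> hom C S (prod_obj C X Y)"
    and "proj1 C X Y \<cdot> pairing C x y = x"
    and "proj2 C X Y \<cdot> pairing C x y = y"
  using theI'[OF prod_universal[OF x y]] by (simp_all add: pairing_def homD[OF x] homD[OF y])

lemma pairing_eqI:
  assumes h: "h \<in> hom C S (prod_obj C X Y)"
    and x: "x \<in> hom C S X" "proj1 C X Y \<cdot> h = x" and y: "y \<in> hom C S Y" "proj2 C X Y \<cdot> h = y"
  shows "h = pairing C x y"
  using prod_universal[OF x(1) y(1)] pairing_props[OF x(1) y(1)] assms by blast

lemma pairing_Comp:
  assumes x: "x \<in> hom C S X" and y: "y \<in> hom C S Y" and t: "t \<in> hom C T S"
  shows "pairing C x y \<cdot> t = pairing C (x \<cdot> t) (y \<cdot> t)"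
proof (rule pairing_eqI)
  note pr = proj_in_hom[OF hom_objects(2)[OF x] hom_objects(2)[OF y]]
  note pair = pairing_props[OF x y]
  show "pairing C x y \<cdot> t \<in> hom C T (prod_obj C X Y)"
    using Comp_in_hom[OF t pair(1)] .
  show "proj1 C X Y \<cdot> (pairing C x y \<cdot> t) = x \<cdot> t" "proj2 C X Y \<cdot> (pairing C x y \<cdot> t) = y \<cdot> t"
    using Comp_assoc[OF t pair(1) pr(1)] Comp_assoc[OF t pair(1) pr(2)] pair(2,3) by simp_all
qed (use Comp_in_hom[OF t] x y in auto)

lemma prod_mor_in_hom:
  assumes "g \<in> hom C X X'" "h \<in> hom C Y Y'"
  shows "prod_mor C g h \<in> hom C (prod_obj C X Y) (prod_obj C X' Y')"
proof -
  note pr = proj_in_hom[OF hom_objects(1)[OF assms(1)] hom_objects(1)[OF assms(2)]]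
  show ?thesis
    unfolding prod_mor_def homD[OF assms(1)] homD[OF assms(2)]
    using pairing_props(1)[OF Comp_in_hom[OF pr(1) assms(1)] Comp_in_hom[OF pr(2) assms(2)]] .
qed

lemma prod_mor_Comp_pairing:
  assumes g: "g \<in> hom C X X'" and h: "h \<in> hom C Y Y'"
    and x: "x \<in> hom C S X" and y: "y \<in> hom C S Y"
  shows "prod_mor C g h \<cdot> pairing C x y = pairing C (g \<cdot> x) (h \<cdot> y)"
proof -
  note pr = proj_in_hom[OF hom_objects(2)[OF x] hom_objects(2)[OF y]]
  note pair = pairing_props[OF x y]
  have "prod_mor C g h \<cdot> pairing C x y =
      pairing C ((g \<cdot> proj1 C X Y) \<cdot> pairing C x y) ((h \<cdot> proj2 C X Y) \<cdot> pairing C x y)"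
    unfolding prod_mor_def homD[OF g] homD[OF h]
    by (rule pairing_Comp[OF Comp_in_hom[OF pr(1) g] Comp_in_hom[OF pr(2) h] pair(1)])
  then show ?thesis
    using Comp_assoc[OF pair(1) pr(1) g] Comp_assoc[OF pair(1) pr(2) h] pair(2,3) by simp
qed

end

section \<open>Cancellation in pointed categories\<close>

context pointed_category
begin

lemma zero_morE:
  assumes "X \<in> Obj C" "Y \<in> Obj C"
  obtains N a b where "is_zero_object C N" "a \<in> hom C X N" "b \<in> hom C N Y"
    "zero_mor C X Y = b \<cdot> a"
proof -
  obtain N where N: "is_zero_object C N"
    using ex_zero_object by blast
  moreover from N assms obtain a b where "a \<in> hom C X N" "b \<in> hom C N Y"
    unfolding is_zero_object_def is_initial_def is_terminal_def by blast
  ultimately show thesis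
    using that zero_mor_eq_Comp by blast
qed

lemma zero_mor_in_hom:
  assumes "X \<in> Obj C" "Y \<in> Obj C"
  shows "zero_mor C X Y \<in> hom C X Y"
  using zero_morE[OF assms] Comp_in_hom by metis

lemma zero_mor_Comp:
  assumes Y: "Y \<in> Obj C" and t: "t \<in> hom C T X"
  shows "zero_mor C X Y \<cdot> t = zero_mor C T Y"
proof -
  obtain N a b where N: "is_zero_object C N" and a: "a \<in> hom C X N" and b: "b \<in> hom C N Y"
    and eq: "zero_mor C X Y = b \<cdot> a"
    using zero_morE[OF hom_objects(2)[OF t] Y] .
  have "zero_mor C X Y \<cdot> t = b \<cdot> (a \<cdot> t)"
    using Comp_assoc[OF t a b] eq by simp
  also have "\<dots> = zero_mor C T Y"
    using zero_mor_eq_Comp[OF N Comp_in_hom[OF t a] b] by simp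
  finally show ?thesis .
qed

end

locale pointed_category_with_binary_products =
  pointed_category + category_with_binary_products
begin

text \<open>
  Both \<open>0 \<circ> \<pi>\<^sub>2\<close> and \<open>0 \<circ> \<pi>\<^sub>1\<close> are the zero morphism \<open>S \<times> S \<rightarrow> Y\<close>, so the second projection can be
  traded for the first. This is how a condition on \<open>f (x, 0)\<close> becomes one on \<open>f (x \<times> 0)\<close>.
\<close>

lemma prod_mor_zero:
  assumes x: "x \<in> hom C S X" and Y: "Y \<in> Obj C"
  shows "prod_mor C x (zero_mor C S Y) = pairing C x (zero_mor C S Y) \<cdot> proj1 C S S"
proof -
  have S: "S \<in> Obj C" using hom_objects[OF x] by simp
  note z = zero_mor_in_hom[OF S Y] and pr = proj_in_hom[OF S S]
  show ?thesis
    unfolding prod_mor_def homD[OF x] homD[OF z] pairing_Comp[OF x z pr(1)]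
    by (simp add: zero_mor_Comp[OF Y pr(1)] zero_mor_Comp[OF Y pr(2)])
qed

text \<open>
  Descending \<open>f\<close> along \<open>q \<times> 1\<close>, where \<open>q\<close> coequalises \<open>x\<close> and \<open>x'\<close>, makes \<open>f (x, y)\<close> depend on
  \<open>x\<close> only through \<open>q x = q x'\<close>.
\<close>

lemma centralic_cancellation:
  assumes coeq: "has_coequalisers C"
    and comm: "binary_products_commute_with_coequalisers C"
    and Y: "Y \<in> Obj C" and f: "f \<in> hom C (prod_obj C X Y) Z"
    and x: "x \<in> hom C S X" and x': "x' \<in> hom C S X" and y: "y \<in> hom C S Y"
    and eq: "f \<cdot> pairing C x (zero_mor C S Y) = f \<cdot> pairing C x' (zero_mor C S Y)"
  shows "f \<cdot> pairing C x y = f \<cdot> pairing C x' y"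
proof -
  let ?z = "zero_mor C S Y"
  have S: "S \<in> Obj C" and X: "X \<in> Obj C" using hom_objects[OF x] by auto
  note z = zero_mor_in_hom[OF S Y] and p1 = proj_in_hom(1)[OF S S]
  obtain q where cq: "is_coequaliser C x x' q"
    using coeq S X x x' unfolding has_coequalisers_def by blast
  then obtain Q where q: "q \<in> hom C X Q" and qx: "q \<cdot> x = q \<cdot> x'"
    using x unfolding is_coequaliser_def by (metis homD(2))
  have i: "Ide C Y \<in> hom C Y Y" using Ide_in_hom[OF Y] .
  let ?q1 = "prod_mor C q (Ide C Y)"
  have q1: "?q1 \<in> hom C (prod_obj C X Y) (prod_obj C Q Y)"
    using prod_mor_in_hom[OF q i] .
  have c: "is_coequaliser C (prod_mor C x ?z) (prod_mor C x' ?z) ?q1"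
    using comm cq coequaliser_of_equal_pair[OF z]
    unfolding binary_products_commute_with_coequalisers_def by blast
  \<comment> \<open>\<open>f\<close> coequalises the pair because \<open>f (x \<times> 0) = f (x, 0) \<pi>\<^sub>1 = f (x', 0) \<pi>\<^sub>1 = f (x' \<times> 0)\<close>.\<close>
  have "f \<cdot> prod_mor C x ?z = f \<cdot> prod_mor C x' ?z"
    using eq Comp_assoc[OF p1 pairing_props(1)[OF x z] f]
      Comp_assoc[OF p1 pairing_props(1)[OF x' z] f]
    by (simp add: prod_mor_zero[OF x Y] prod_mor_zero[OF x' Y])
  then obtain k where k: "k \<in> hom C (prod_obj C Q Y) Z" and fk: "k \<cdot> ?q1 = f"
    using coequaliser_factorisation[OF c prod_mor_in_hom[OF x z] f] homD(2)[OF q1] by metis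
  have fact: "f \<cdot> pairing C w y = k \<cdot> pairing C (q \<cdot> w) y" if w: "w \<in> hom C S X" for w
    using Comp_assoc[OF pairing_props(1)[OF w y] q1 k] fk
      prod_mor_Comp_pairing[OF q i w y] Ide_Comp[OF y] by simp
  show ?thesis
    using fact[OF x] fact[OF x'] qx by simp
qed

end

theorem proposition2p5:
  fixes C :: "('o, 'm, 'e) category_data_scheme"
  assumes "pointed_category C"
    and "has_binary_products C"
    and "has_coequalisers C"
    and "binary_products_commute_with_coequalisers C"
  shows "centralic C"
proof -
  interpret pointed_category C by fact
  interpret pointed_category_with_binary_products C
    by unfold_locales fact
  obtain N where "is_terminal C N"
    using ex_zero_object by (auto simp: is_zero_object_def)
  then have "has_finite_products C"
    using finite_products_from_binary_products assms(2) by blast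
  then show ?thesis
    unfolding centralic_def using assms(1) centralic_cancellation[OF assms(3,4)] by blast
qed

end
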